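(* Let $X_0,X_1,\ldots$ be a stationary stochastic process and let $(u_n)_{n\in\mathbb N}$ be a sequence of real levels such that $n\,\mathbb P(X_0>u_n)\to\tau$ as $n\to\infty$, for some $\tau>0$. Assume that, for some $q\in\mathbb N_0$, the conditions $\mathbf D(u_n)$ and $\mathbf D'_q(u_n)$ (defined in the context) hold; let $\gamma(q,n,t)$ be the function and $(t_n)_{n\in\mathbb N}$ the sequence (for this $q$) in condition $\mathbf D(u_n)$, and let $(k_n)_{n\in\mathbb N}$ be the sequence in condition $\mathbf D'_q(u_n)$. Then there exists $C>0$ such that for all $n$ large enough $$\begin{aligned}\big|\mathbb P(M_n\le u_n)-e^{-\theta_n\tau}\big|\le C\Bigg[&k_nt_n\frac{\tau}{n}+n\gamma(q,n,t_n)+n\sum_{j=q+1}^{\lfloor n/k_n\rfloor-1}\mathbb P\left(A_n^{(q)}\cap T^{-j}(A_n^{(q)})\right)\\&+e^{-\theta_n\tau}\left(\left|\tau-n\mathbb P(U_n)\right|+\frac{\tau^2}{k_n}\right)+q\,\mathbb P\left(U_n\setminus A_n^{(q)}\right)\Bigg],\end{aligned}$$ where $\theta_n=\mathbb P(A_n^{(q)})/\mathbb P(U_n)$.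
   Context: $\mathbb N=\{1,2,\ldots\}$, $\mathbb N_0=\mathbb N\cup\{0\}$. The random variables $X_i:\mathcal Y\to\mathbb R$ are defined on a probability space $(\mathcal Y,\mathcal B,\mathbb P)$, where $\mathcal Y$ is a sequence space with natural product structure (each realisation of the process corresponds to a unique element of $\mathcal Y$), and there is a measurable map $T:\mathcal Y\to\mathcal Y$ with $X_{i-1}\circ T=X_i$ for all $i\in\mathbb N$. Stationarity means $\mathbb P$ is $T$-invariant. $T^{-i}$ denotes preimage under $T^i$, and $B^c$ is the complement of $B$. $M_n=\max\{X_0,\ldots,X_{n-1}\}$. For $u\in\mathbb R$ and $q\in\mathbb N$: $U(u)=\{X_0>u\}$, $A^{(q)}(u)=U(u)\cap\bigcap_{i=1}^q T^{-i}(U(u)^c)=\{X_0>u,X_1\le u,\ldots,X_q\le u\}$, and $A^{(0)}(u)=U(u)$. Write $U_n=U(u_n)$, $A_n^{(q)}=A^{(q)}(u_n)$. For $B\in\mathcal B$ and $s,\ell\ge0$: $\mathscr W_{s,\ell}(B)=\bigcap_{i=\lfloor s\rfloor}^{\lfloor s\rfloor+\max\{\lfloor\ell\rfloor-1,0\}}T^{-i}(B^c)$. Condition $\mathbf D(u_n)$ holds for the process if for every $\ell,t,n\in\mathbb N$ and $q\in\mathbb N_0$, $$\left|\mathbb P\left(A_n^{(q)}\cap\mathscr W_{t,\ell}(A_n^{(q)})\right)-\mathbb P(A_n^{(q)})\,\mathbb P\left(\mathscr W_{0,\ell}(A_n^{(q)})\right)\right|\le\gamma(q,n,t),$$ where $\gamma(q,n,t)$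 is decreasing in $t$ for each $q,n$ and, for every $q\in\mathbb N_0$, there exists a sequence $(t_n)_{n\in\mathbb N}$ of positive integers with $t_n=o(n)$ and $n\gamma(q,n,t_n)\to0$ as $n\to\infty$. Condition $\mathbf D'_q(u_n)$ holds (for a fixed $q\in\mathbb N_0$, with $(t_n)$ the sequence given by $\mathbf D(u_n)$ for this $q$) if there exists a sequence $(k_n)_{n\in\mathbb N}$ of positive integers with $k_n\to\infty$ and $k_nt_n=o(n)$ such that $$\lim_{n\to\infty}n\sum_{j=q+1}^{\lfloor n/k_n\rfloor-1}\mathbb P\left(A_n^{(q)}\cap T^{-j}(A_n^{(q)})\right)=0.$$ *)

theory Defs
  imports "HOL-Probability.Probability" "HOL-Library.Landau_Symbols"
begin

(* The underlying space is an arbitrary probability space carrying a measurable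
   measure-preserving map T that realises the time shift of the process.  The usual
   model, a sequence space with its product structure and the left shift, is one
   instance. *)

locale stationary_process = prob_space M
  for M :: "'a measure" and T :: "'a \<Rightarrow> 'a" and X :: "nat \<Rightarrow> 'a \<Rightarrow> real" +
  assumes X_measurable: "X i \<in> borel_measurable M"
    and T_measurable: "T \<in> measurable M M"
    and X_shift: "x \<in> space M \<Longrightarrow> X i (T x) = X (Suc i) x"
    and T_invariant: "distr M M T = M"

definition preimage_iter :: "'a measure \<Rightarrow> ('a \<Rightarrow> 'a) \<Rightarrow> nat \<Rightarrow> 'a set \<Rightarrow> 'a set" where
  "preimage_iter M T i B = (T ^^ i) -` B \<inter> space M"

definition partial_max :: "(nat \<Rightarrow> 'a \<Rightarrow> real) \<Rightarrow> nat \<Rightarrow> 'a \<Rightarrow> real" where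
  "partial_max X n x = Max ((\<lambda>i. X i x) ` {..<n})"

definition exceedance :: "'a measure \<Rightarrow> (nat \<Rightarrow> 'a \<Rightarrow> real) \<Rightarrow> real \<Rightarrow> 'a set" where
  "exceedance M X v = {x \<in> space M. X 0 x > v}"

(* For q = 0 the intersection is over the empty index set, hence UNIV, and the result
   is exceedance M X v. *)

definition escape_set ::
  "'a measure \<Rightarrow> ('a \<Rightarrow> 'a) \<Rightarrow> (nat \<Rightarrow> 'a \<Rightarrow> real) \<Rightarrow> nat \<Rightarrow> real \<Rightarrow> 'a set" where
  "escape_set M T X q v =
     exceedance M X v \<inter> (\<Inter>i\<in>{1..q}. preimage_iter M T i (space M - exceedance M X v))"

(* Meant for s, l >= 0, where nat of the floor is the integer part.  As in the source
   convention, a window of length l < 1 still contains the single time floor s. *)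

definition no_visit ::
  "'a measure \<Rightarrow> ('a \<Rightarrow> 'a) \<Rightarrow> real \<Rightarrow> real \<Rightarrow> 'a set \<Rightarrow> 'a set" where
  "no_visit M T s l B =
     (\<Inter>i\<in>{nat \<lfloor>s\<rfloor>..nat \<lfloor>s\<rfloor> + nat (max (\<lfloor>l\<rfloor> - 1) 0)}. preimage_iter M T i (space M - B))"

definition theta ::
  "'a measure \<Rightarrow> ('a \<Rightarrow> 'a) \<Rightarrow> (nat \<Rightarrow> 'a \<Rightarrow> real) \<Rightarrow> nat \<Rightarrow> real \<Rightarrow> real" where
  "theta M T X q v = measure M (escape_set M T X q v) / measure M (exceedance M X v)"

(* Sequences are indexed by the positive integers; values at index 0 are irrelevant
   throughout. *)

definition gap_sequence :: "(nat \<Rightarrow> nat \<Rightarrow> nat \<Rightarrow> real) \<Rightarrow> nat \<Rightarrow> (nat \<Rightarrow> nat) \<Rightarrow> bool" where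
  "gap_sequence \<gamma> q t \<longleftrightarrow>
     (\<forall>n\<ge>1. t n \<ge> 1) \<and>
     (\<lambda>n. real (t n)) \<in> o(\<lambda>n. real n) \<and>
     (\<lambda>n. real n * \<gamma> q n (t n)) \<longlonglongrightarrow> 0"

(* Condition D(u_n), with the rate function gamma made explicit. *)

definition cond_D ::
  "'a measure \<Rightarrow> ('a \<Rightarrow> 'a) \<Rightarrow> (nat \<Rightarrow> 'a \<Rightarrow> real) \<Rightarrow> (nat \<Rightarrow> real) \<Rightarrow>
   (nat \<Rightarrow> nat \<Rightarrow> nat \<Rightarrow> real) \<Rightarrow> bool" where
  "cond_D M T X u \<gamma> \<longleftrightarrow>
     (\<forall>q. \<forall>n\<ge>1. \<forall>t\<ge>1. \<forall>l\<ge>1.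
        \<bar>measure M (escape_set M T X q (u n)
                     \<inter> no_visit M T (real t) (real l) (escape_set M T X q (u n)))
          - measure M (escape_set M T X q (u n))
            * measure M (no_visit M T 0 (real l) (escape_set M T X q (u n)))\<bar>
        \<le> \<gamma> q n t) \<and>
     (\<forall>q. \<forall>n\<ge>1. antimono_on {1..} (\<gamma> q n)) \<and>
     (\<forall>q. \<exists>t. gap_sequence \<gamma> q t)"

(* The sum over j in D'_q.  The upper limit is floor (n / k) - 1; truncated subtraction
   is harmless since the lower limit is positive. *)

definition clustering_sum ::
  "'a measure \<Rightarrow> ('a \<Rightarrow> 'a) \<Rightarrow> (nat \<Rightarrow> 'a \<Rightarrow> real) \<Rightarrow> nat \<Rightarrow> real \<Rightarrow> nat \<Rightarrow> nat \<Rightarrow> real" where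
  "clustering_sum M T X q v n k =
     (\<Sum>j = q + 1..n div k - 1.
        measure M (escape_set M T X q v \<inter> preimage_iter M T j (escape_set M T X q v)))"

(* Condition D'_q(u_n), with the gap sequence t coming from D(u_n) and the block-number
   sequence k made explicit. *)

definition cond_D' ::
  "'a measure \<Rightarrow> ('a \<Rightarrow> 'a) \<Rightarrow> (nat \<Rightarrow> 'a \<Rightarrow> real) \<Rightarrow> (nat \<Rightarrow> real) \<Rightarrow> nat \<Rightarrow>
   (nat \<Rightarrow> nat) \<Rightarrow> (nat \<Rightarrow> nat) \<Rightarrow> bool" where
  "cond_D' M T X u q t k \<longleftrightarrow>
     (\<forall>n\<ge>1. k n \<ge> 1) \<and>
     filterlim k at_top sequentially \<and>
     (\<lambda>n. real (k n) * real (t n)) \<in> o(\<lambda>n. real n) \<and>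
     (\<lambda>n. real n * clustering_sum M T X q (u n) n (k n)) \<longlonglongrightarrow> 0"

end

theory Submission
  imports Defs
begin

text \<open>
  Write \<open>A\<close> for the escape set and \<open>p\<close> for its probability. An exceedance before time \<open>n\<close>
  without a visit to \<open>A\<close> must have its last exceedance among the final \<open>q\<close> times, and this
  time is a visit to \<open>U - A\<close>; so the event that the maximum stays below the level may be
  replaced by the event that \<open>A\<close> is not visited, at the cost \<open>q * P(U - A)\<close>.
  Split \<open>{..<n}\<close> into \<open>k\<close> blocks of length \<open>l = n div k\<close>. By Bonferroni's inequality and
  mixing across a gap of length \<open>t\<close>, prefixing one block multiplies the probability of not
  visiting \<open>A\<close> by \<open>1 - l * p\<close>, up to an error \<open>2 * t * p + l * (S + \<gamma>)\<close> with \<open>S\<close> the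
  clustering sum. Iterating gives \<open>(1 - l * p) ^ k\<close>, which is within \<open>k * (l * p)\<^sup>2\<close> of
  \<open>exp (- k * l * p)\<close>. The factor \<open>exp (- \<theta> * \<tau>)\<close> in the bound is harmless, because
  \<open>\<theta> \<le> 1\<close> keeps it above \<open>exp (- \<tau>)\<close>.
\<close>

section \<open>Elementary inequalities for powers and exponentials\<close>

lemma abs_power_diff_le:
  fixes x y :: real
  assumes "0 \<le> x" "x \<le> 1" "0 \<le> y" "y \<le> 1"
  shows "\<bar>x ^ k - y ^ k\<bar> \<le> real k * \<bar>x - y\<bar>"
proof (induction k)
  case (Suc k)
  have "x ^ Suc k - y ^ Suc k = x * (x ^ k - y ^ k) + (x - y) * y ^ k"
    by (simp add: algebra_simps)
  also have "\<bar>\<dots>\<bar> \<le> x * \<bar>x ^ k - y ^ k\<bar> + \<bar>x - y\<bar> * y ^ k"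
    using assms by (intro order.trans[OF abs_triangle_ineq]) (simp add: abs_mult)
  also have "\<dots> \<le> 1 * (real k * \<bar>x - y\<bar>) + \<bar>x - y\<bar> * 1"
    using assms Suc.IH by (intro add_mono mult_mono) (auto intro: power_le_one)
  finally show ?case by (simp add: algebra_simps)
qed simp

lemma abs_one_minus_diff_exp_le:
  fixes x :: real
  assumes "0 \<le> x"
  shows "\<bar>(1 - x) - exp (- x)\<bar> \<le> x\<^sup>2"
proof -
  have "1 - x \<le> exp (- x)"
    using exp_ge_add_one_self[of "- x"] by simp
  moreover have "exp (- x) \<le> 1 / (1 + x)"
    using exp_ge_add_one_self[of x] assms
    by (simp add: exp_minus inverse_eq_divide divide_simps add_pos_nonneg)
  moreover have "1 / (1 + x) \<le> 1 - x + x\<^sup>2"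
    using assms by (simp add: divide_simps power2_eq_square algebra_simps add_pos_nonneg)
  ultimately show ?thesis by simp
qed

lemma abs_exp_minus_diff_le:
  fixes x y :: real
  assumes "0 \<le> x" "0 \<le> y"
  shows "\<bar>exp (- x) - exp (- y)\<bar> \<le> \<bar>x - y\<bar>"
proof -
  have *: "exp (- a) - exp (- b) \<le> b - a" if "0 \<le> a" "a \<le> b" for a b :: real
  proof -
    have "exp (- a) - exp (- b) = exp (- a) * (1 - exp (- (b - a)))"
      by (simp add: algebra_simps exp_diff exp_minus field_simps)
    also have "\<dots> \<le> 1 * (b - a)"
      using that exp_ge_add_one_self[of "a - b"] by (intro mult_mono) (auto simp: algebra_simps)
    finally show ?thesis by simp
  qed
  have "exp (- a) - exp (- b) \<ge> 0" if "a \<le> b" for a b :: real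
    using that by simp
  then show ?thesis
    using *[of x y] *[of y x] assms by (cases "x \<le> y") (auto simp: abs_if)
qed

text \<open>Both terms are \<open>k\<close>-th powers of numbers in [0,1], with bases
  \<open>1 - x\<close> and \<open>exp (- x)\<close>, so their difference is at most \<open>k\<close>
  times that of the bases, which is of second order in \<open>x\<close>.\<close>

lemma abs_power_diff_exp_le:
  fixes x :: real
  assumes "0 \<le> x" "x \<le> 1"
  shows "\<bar>(1 - x) ^ k - exp (- (real k * x))\<bar> \<le> real k * x\<^sup>2"
proof -
  have "exp (- (real k * x)) = exp (- x) ^ k"
    by (simp flip: exp_of_nat_mult)
  then have "\<bar>(1 - x) ^ k - exp (- (real k * x))\<bar> \<le> real k * \<bar>(1 - x) - exp (- x)\<bar>"
    using abs_power_diff_le[of "1 - x" "exp (- x)" k] assms by simp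
  also have "\<dots> \<le> real k * x\<^sup>2"
    using abs_one_minus_diff_exp_le[OF assms(1)] by (intro mult_left_mono) auto
  finally show ?thesis .
qed

text \<open>Since \<open>c\<close> is at most 1, multiplying by it does not amplify the error made
  so far. Each of the \<open>k\<close> steps therefore adds at most \<open>e\<close>.\<close>

lemma geometric_recursion_bound:
  fixes v :: "nat \<Rightarrow> real"
  assumes "v 0 = 1" "0 \<le> c" "c \<le> 1"
    and "\<And>m. \<bar>v (l + m) - c * v m\<bar> \<le> e"
  shows "\<bar>v (k * l) - c ^ k\<bar> \<le> real k * e"
proof (induction k)
  case (Suc k)
  have "\<bar>c * v (k * l) - c * c ^ k\<bar> = c * \<bar>v (k * l) - c ^ k\<bar>"
    using assms(2) by (simp add: abs_mult flip: right_diff_distrib)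
  also have "\<dots> \<le> 1 * (real k * e)"
    using assms(2,3) Suc.IH by (intro mult_mono) auto
  finally show ?case
    using assms(4)[of "k * l"] by (simp add: algebra_simps)
qed (use assms in simp)

section \<open>Iterates of the shift, stationarity, and avoidance events\<close>

lemma funpow_funpow_apply: "(f ^^ i) ((f ^^ j) x) = (f ^^ (j + i)) x"
  by (metis add.commute comp_apply funpow_add)

text \<open>A counterpart of \<open>no_visit\<close> with a half-open window of natural length. The
  empty window gives the whole space, so a recursion over blocks starts at probability 1.\<close>

definition avoid :: "'a measure \<Rightarrow> ('a \<Rightarrow> 'a) \<Rightarrow> 'a set \<Rightarrow> nat \<Rightarrow> 'a set" where
  "avoid M T A m = {x \<in> space M. \<forall>i<m. (T ^^ i) x \<notin> A}"

context stationary_process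
begin

lemma funpow_in_space: "x \<in> space M \<Longrightarrow> (T ^^ i) x \<in> space M"
  by (induction i) (auto intro: measurable_space[OF T_measurable])

lemma measurable_funpow [measurable]: "T ^^ i \<in> measurable M M"
proof (induction i)
  case (Suc i)
  then show ?case using measurable_comp[OF _ T_measurable] by (simp add: comp_def)
qed (simp add: id_def)

lemma distr_funpow: "distr M M (T ^^ i) = M"
proof (induction i)
  case (Suc i)
  have "distr M M (T ^^ Suc i) = distr (distr M M (T ^^ i)) M T"
    by (simp add: distr_distr[OF T_measurable measurable_funpow])
  then show ?case by (simp add: Suc T_invariant comp_def)
qed (simp add: id_def distr_id)

lemma sets_preimage_iter [measurable]:
  "B \<in> sets M \<Longrightarrow> preimage_iter M T i B \<in> sets M"
  unfolding preimage_iter_def by (rule measurable_sets[OF measurable_funpow])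

lemma prob_preimage_iter: "B \<in> sets M \<Longrightarrow> prob (preimage_iter M T i B) = prob B"
  using measure_distr[OF measurable_funpow, of B i] by (simp add: distr_funpow preimage_iter_def)

lemma preimage_iter_iff: "x \<in> preimage_iter M T i B \<longleftrightarrow> x \<in> space M \<and> (T ^^ i) x \<in> B"
  by (auto simp: preimage_iter_def)

lemma preimage_iter_add:
  "preimage_iter M T (i + j) B = preimage_iter M T i (preimage_iter M T j B)"
  by (auto simp: preimage_iter_iff funpow_in_space funpow_funpow_apply)

lemma preimage_iter_Int:
  "preimage_iter M T i (B \<inter> C) = preimage_iter M T i B \<inter> preimage_iter M T i C"
  by (auto simp: preimage_iter_def)

lemma prob_UN_preimage_iter_le:
  assumes "A \<in> sets M" "finite I"
  shows "prob (\<Union>i\<in>I. preimage_iter M T i A) \<le> real (card I) * prob A"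
proof -
  have "prob (\<Union>i\<in>I. preimage_iter M T i A) \<le> (\<Sum>i\<in>I. prob (preimage_iter M T i A))"
    using assms by (intro finite_measure_subadditive_finite) auto
  then show ?thesis by (simp add: prob_preimage_iter assms)
qed

text \<open>The union bound in the form used to change a time window: by stationarity, each time
  added or dropped costs at most one copy of \<open>prob A\<close>.\<close>

lemma prob_le_add_UN_preimage_iter:
  assumes "A \<in> sets M" "B \<in> sets M" "C \<in> sets M" "finite I"
    and "B \<subseteq> C \<union> (\<Union>i\<in>I. preimage_iter M T i A)"
  shows "prob B \<le> prob C + real (card I) * prob A"
proof -
  have UN: "(\<Union>i\<in>I. preimage_iter M T i A) \<in> sets M"
    using assms by auto
  have "prob B \<le> prob (C \<union> (\<Union>i\<in>I. preimage_iter M T i A))"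
    using assms UN by (intro finite_measure_mono) auto
  also have "\<dots> \<le> prob C + prob (\<Union>i\<in>I. preimage_iter M T i A)"
    using assms UN by (intro measure_Un_le) auto
  finally show ?thesis
    using prob_UN_preimage_iter_le[OF assms(1,4)] by simp
qed

lemma avoid_eq_Diff: "avoid M T A m = space M - (\<Union>i<m. preimage_iter M T i A)"
  by (auto simp: avoid_def preimage_iter_iff)

lemma preimage_iter_avoid:
  "preimage_iter M T j (avoid M T A m) = {x \<in> space M. \<forall>i<m. (T ^^ (j + i)) x \<notin> A}"
  by (auto simp: preimage_iter_iff avoid_def funpow_in_space funpow_funpow_apply)

lemma sets_avoid [measurable]: "A \<in> sets M \<Longrightarrow> avoid M T A m \<in> sets M"
  unfolding avoid_eq_Diff by auto

lemma prob_avoid_mono: "A \<in> sets M \<Longrightarrow> m \<le> m' \<Longrightarrow> prob (avoid M T A m') \<le> prob (avoid M T A m)"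
  by (intro finite_measure_mono) (auto simp: avoid_def)

lemma prob_avoid_le_add:
  assumes "A \<in> sets M" "m \<le> m'"
  shows "prob (avoid M T A m) \<le> prob (avoid M T A m') + real (m' - m) * prob A"
proof -
  have "avoid M T A m \<subseteq> avoid M T A m' \<union> (\<Union>i\<in>{m..<m'}. preimage_iter M T i A)"
    by (fastforce simp: avoid_def preimage_iter_iff not_less)
  from prob_le_add_UN_preimage_iter[OF assms(1) _ _ _ this] assms show ?thesis by simp
qed

section \<open>Bonferroni's inequality and the block estimates\<close>

lemma prob_Int_preimage_iter_pair:
  assumes "A \<in> sets M" "i \<le> j"
  shows "prob (preimage_iter M T i A \<inter> preimage_iter M T j A) =
    prob (A \<inter> preimage_iter M T (j - i) A)"
proof -
  have "preimage_iter M T i A \<inter> preimage_iter M T j A =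
      preimage_iter M T i (A \<inter> preimage_iter M T (j - i) A)"
    using preimage_iter_add[of i "j - i" A] assms(2) by (simp add: preimage_iter_Int)
  then show ?thesis using assms(1) by (simp add: prob_preimage_iter)
qed

text \<open>Adjoining the visit at time \<open>s\<close> to a union of earlier visits miscounts only
  its overlap with them. By stationarity a pair of visits depends on its lag alone, and the lags 1,
  ..., \<open>s\<close> all occur in the sum on the right. Keeping \<open>l\<close> apart from the
  induction variable \<open>s\<close> leaves that sum fixed.\<close>

lemma bonferroni_preimage_iter:
  assumes A: "A \<in> sets M" and F: "F \<in> sets M"
    and "s \<le> l"
  shows "\<bar>prob ((\<Union>i<s. preimage_iter M T i A) \<inter> F) - (\<Sum>i<s. prob (preimage_iter M T i A \<inter> F))\<bar>
    \<le> real s * (\<Sum>j = 1..l - 1. prob (A \<inter> preimage_iter M T j A))"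
  using \<open>s \<le> l\<close>
proof (induction s)
  case (Suc s)
  define E where "E i = preimage_iter M T i A" for i
  define S where "S = (\<Sum>j = 1..l - 1. prob (A \<inter> preimage_iter M T j A))"
  have E [measurable]: "E i \<in> sets M" for i
    using A by (simp add: E_def)
  have UN: "(\<Union>i<s. E i) \<in> sets M" by auto
  \<comment> \<open>The restriction to \<open>F\<close> is given up here, so the overlap is bounded
    by pair probabilities of \<open>A\<close> alone.\<close>
  have "prob ((\<Union>i<s. E i) \<inter> F \<inter> (E s \<inter> F)) \<le> prob (\<Union>i<s. E i \<inter> E s)"
    by (intro finite_measure_mono) auto
  also have "\<dots> \<le> (\<Sum>i<s. prob (E i \<inter> E s))"
    by (intro finite_measure_subadditive_finite) auto
  also have "\<dots> = (\<Sum>i<s. prob (A \<inter> preimage_iter M T (s - i) A))"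
    by (simp add: E_def prob_Int_preimage_iter_pair[OF A])
  also have "\<dots> = (\<Sum>j = 1..s. prob (A \<inter> preimage_iter M T j A))"
    by (rule sum.reindex_bij_witness[of _ "\<lambda>j. s - j" "\<lambda>i. s - i"]) auto
  also have "\<dots> \<le> S"
    unfolding S_def using Suc.prems by (intro sum_mono2) auto
  finally have overlap: "prob ((\<Union>i<s. E i) \<inter> F \<inter> (E s \<inter> F)) \<le> S" .
  have Suc_eq: "(\<Union>i<Suc s. E i) \<inter> F = ((\<Union>i<s. E i) \<inter> F) \<union> (E s \<inter> F)"
    by (auto simp: less_Suc_eq)
  have "prob (((\<Union>i<s. E i) \<inter> F) \<union> (E s \<inter> F)) =
      prob ((\<Union>i<s. E i) \<inter> F) + prob (E s \<inter> F) - prob ((\<Union>i<s. E i) \<inter> F \<inter> (E s \<inter> F))"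
    using UN F by (intro measure_Un3) (auto simp: fmeasurable_eq_sets)
  moreover have "\<bar>prob ((\<Union>i<s. E i) \<inter> F) - (\<Sum>i<s. prob (E i \<inter> F))\<bar> \<le> real s * S"
    unfolding E_def S_def using Suc by simp
  ultimately have "\<bar>prob ((\<Union>i<Suc s. E i) \<inter> F) - (\<Sum>i<Suc s. prob (E i \<inter> F))\<bar>
      \<le> real (Suc s) * S"
    using overlap measure_nonneg[of M "(\<Union>i<s. E i) \<inter> F \<inter> (E s \<inter> F)"]
    unfolding Suc_eq of_nat_Suc distrib_right sum.lessThan_Suc mult_1 by linarith
  then show ?case by (simp add: E_def S_def)
qed simp

text \<open>The comparison goes through avoiding \<open>A\<close> during the first \<open>l\<close>
  times and again on a window of length \<open>m\<close> that starts after a gap of length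
  \<open>t\<close>. One \<open>t * prob A\<close> pays for visits inside the gap, the other for
  shortening the total window from \<open>l + t + m\<close> to \<open>l + m\<close>.\<close>

lemma avoid_block_bound:
  assumes A: "A \<in> sets M"
    and mix: "\<And>j. t \<le> j \<Longrightarrow>
      \<bar>prob (A \<inter> preimage_iter M T j (avoid M T A m)) - prob A * prob (avoid M T A m)\<bar> \<le> g"
  shows "\<bar>prob (avoid M T A (l + m)) - (1 - real l * prob A) * prob (avoid M T A m)\<bar>
    \<le> 2 * (real t * prob A) + real l * (\<Sum>j = 1..l - 1. prob (A \<inter> preimage_iter M T j A))
      + real l * g"
proof -
  define F where "F = preimage_iter M T (l + t) (avoid M T A m)"
  define E where "E i = preimage_iter M T i A" for i
  have F: "F \<in> sets M" and E: "\<And>i. E i \<in> sets M"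
    using A by (auto simp: F_def E_def)
  have F_iff: "x \<in> F \<longleftrightarrow> x \<in> space M \<and> (\<forall>i<m. (T ^^ (l + t + i)) x \<notin> A)" for x
    by (simp add: F_def preimage_iter_avoid)
  have probF: "prob F = prob (avoid M T A m)"
    using A by (simp add: F_def prob_preimage_iter)
  have "avoid M T A l \<inter> F = F - (\<Union>i<l. E i) \<inter> F"
    by (auto simp: avoid_eq_Diff E_def F_iff)
  moreover have "prob (F - (\<Union>i<l. E i) \<inter> F) = prob F - prob ((\<Union>i<l. E i) \<inter> F)"
    using F E by (intro finite_measure_Diff) auto
  ultimately have split: "prob (avoid M T A l \<inter> F) = prob F - prob ((\<Union>i<l. E i) \<inter> F)"
    by simp
  \<comment> \<open>Seen from a visit at time \<open>i\<close>, the event \<open>F\<close> starts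
    \<open>l + t - i\<close> steps later. This distance is at least \<open>t\<close>, so
    \<open>mix\<close> applies after shifting back by \<open>i\<close>.\<close>
  have pair: "\<bar>prob (E i \<inter> F) - prob A * prob F\<bar> \<le> g" if "i < l" for i
  proof -
    have "E i \<inter> F = preimage_iter M T i (A \<inter> preimage_iter M T (l + t - i) (avoid M T A m))"
      using preimage_iter_add[of i "l + t - i" "avoid M T A m"] that
      by (simp add: E_def F_def preimage_iter_Int)
    then show ?thesis
      using mix[of "l + t - i"] that A by (simp add: probF prob_preimage_iter)
  qed
  have "\<bar>(\<Sum>i<l. prob (E i \<inter> F)) - real l * (prob A * prob F)\<bar> =
      \<bar>\<Sum>i<l. prob (E i \<inter> F) - prob A * prob F\<bar>"
    by (simp add: sum_subtractf)
  also have "\<dots> \<le> (\<Sum>i<l. g)"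
    using pair by (intro order.trans[OF sum_abs] sum_mono) auto
  finally have total: "\<bar>(\<Sum>i<l. prob (E i \<inter> F)) - real l * (prob A * prob F)\<bar> \<le> real l * g"
    by simp
  \<comment> \<open>Only visits during the \<open>t\<close> times of the gap are left uncontrolled
    by the intersection.\<close>
  have "avoid M T A l \<inter> F \<subseteq> avoid M T A (l + t + m) \<union> (\<Union>i\<in>{l..<l + t}. preimage_iter M T i A)"
  proof
    fix x assume x: "x \<in> avoid M T A l \<inter> F"
    then have "x \<in> space M" by (simp add: avoid_def)
    show "x \<in> avoid M T A (l + t + m) \<union> (\<Union>i\<in>{l..<l + t}. preimage_iter M T i A)"
    proof (cases "\<exists>i\<in>{l..<l + t}. (T ^^ i) x \<in> A")
      case True
      with \<open>x \<in> space M\<close> show ?thesis by (auto simp: preimage_iter_iff)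
    next
      case False
      have "(T ^^ i) x \<notin> A" if "i < l + t + m" for i
      proof (cases "i < l + t")
        case True
        then show ?thesis
          using x \<open>\<not> (\<exists>i\<in>{l..<l + t}. (T ^^ i) x \<in> A)\<close> by (cases "i < l") (simp_all add: avoid_def)
      next
        case False
        then have "i - (l + t) < m" using that by simp
        then have "(T ^^ (l + t + (i - (l + t)))) x \<notin> A"
          using x F_iff[of x] by blast
        with False show ?thesis by simp
      qed
      with \<open>x \<in> space M\<close> show ?thesis by (simp add: avoid_def)
    qed
  qed
  from prob_le_add_UN_preimage_iter[OF A _ _ _ this] A F
  have gap: "prob (avoid M T A l \<inter> F) \<le> prob (avoid M T A (l + t + m)) + real t * prob A"
    by simp
  have sub: "prob (avoid M T A (l + t + m)) \<le> prob (avoid M T A l \<inter> F)"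
    using A F by (intro finite_measure_mono) (auto simp: avoid_def F_iff)
  have "prob (avoid M T A (l + m)) \<le> prob (avoid M T A (l + t + m)) + real t * prob A"
    using prob_avoid_le_add[OF A, of "l + m" "l + t + m"] by simp
  moreover have "prob (avoid M T A (l + t + m)) \<le> prob (avoid M T A (l + m))"
    using A by (intro prob_avoid_mono) auto
  moreover have "(1 - real l * prob A) * prob F = prob F - real l * (prob A * prob F)"
    by (simp add: algebra_simps)
  ultimately show ?thesis
    using gap sub split total bonferroni_preimage_iter[OF A F order.refl, of l, folded E_def]
    unfolding probF[symmetric] E_def[symmetric] by linarith
qed

text \<open>The assumption \<open>small\<close> puts \<open>1 - l * p\<close> in [0,1], so the
  recursion can be iterated. The constant 4 collects 2 from the \<open>k\<close> block steps, 1 from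
  the times left over after the last full block, and 1 from replacing \<open>k * l\<close> by
  \<open>n\<close> in the exponent.\<close>

lemma avoid_blocks_bound:
  assumes A: "A \<in> sets M"
    and mix: "\<And>m j. t \<le> j \<Longrightarrow>
      \<bar>prob (A \<inter> preimage_iter M T j (avoid M T A m)) - prob A * prob (avoid M T A m)\<bar> \<le> g"
    and k: "k \<ge> 1" and t: "t \<ge> 1" and small: "real (n div k) * prob A \<le> 1"
  shows "\<bar>prob (avoid M T A n) - exp (- (real n * prob A))\<bar>
    \<le> 4 * (real k * real t * prob A)
      + real n * (\<Sum>j = 1..n div k - 1. prob (A \<inter> preimage_iter M T j A))
      + real n * g + real k * (real (n div k) * prob A)\<^sup>2"
proof -
  define l where "l = n div k"
  define p where "p = prob A"
  define S where "S = (\<Sum>j = 1..l - 1. prob (A \<inter> preimage_iter M T j A))"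
  have p0: "p \<ge> 0" and S0: "S \<ge> 0"
    by (auto simp: p_def S_def intro: sum_nonneg)
  have g0: "g \<ge> 0"
    using mix[of t 0] by linarith
  have kl: "k * l \<le> n" and rest: "n - k * l \<le> k"
    using k by (auto simp: l_def minus_mult_div_eq_mod intro: less_imp_le)
  \<comment> \<open>Fewer than \<open>k\<close> times are left over. As \<open>t\<close> is at least
    1, their cost \<open>k * p\<close> is absorbed into \<open>k * t * p\<close>.\<close>
  have kp: "real k * p \<le> real k * real t * p"
    using t p0 by (simp add: mult_right_mono mult_le_cancel_left1)
  have restp: "real (n - k * l) * p \<le> real k * real t * p"
    using rest p0 by (intro order.trans[OF _ kp] mult_right_mono) auto
  have "\<bar>prob (avoid M T A (k * l)) - (1 - real l * p) ^ k\<bar>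
      \<le> real k * (2 * (real t * p) + real l * S + real l * g)"
  proof (rule geometric_recursion_bound)
    show "prob (avoid M T A 0) = 1"
      by (simp add: avoid_def prob_space)
    show "\<bar>prob (avoid M T A (l + m)) - (1 - real l * p) * prob (avoid M T A m)\<bar>
        \<le> 2 * (real t * p) + real l * S + real l * g" for m
      unfolding p_def S_def by (rule avoid_block_bound[OF A mix])
  qed (use small p0 in \<open>auto simp: p_def l_def\<close>)
  moreover have "real k * (2 * (real t * p) + real l * S + real l * g) =
      2 * (real k * real t * p) + real (k * l) * S + real (k * l) * g"
    by (simp add: algebra_simps)
  moreover have "real (k * l) * S \<le> real n * S" "real (k * l) * g \<le> real n * g"
    using kl S0 g0 by (auto intro!: mult_right_mono simp flip: of_nat_mult)
  moreover have "\<bar>(1 - real l * p) ^ k - exp (- (real k * (real l * p)))\<bar>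
      \<le> real k * (real l * p)\<^sup>2"
    using small p0 by (intro abs_power_diff_exp_le) (auto simp: p_def l_def)
  moreover have "\<bar>exp (- (real k * (real l * p))) - exp (- (real n * p))\<bar>
      \<le> real k * real t * p"
  proof -
    have "\<bar>exp (- (real k * (real l * p))) - exp (- (real n * p))\<bar>
        \<le> \<bar>real k * (real l * p) - real n * p\<bar>"
      using p0 by (intro abs_exp_minus_diff_le) auto
    also have "real k * (real l * p) - real n * p = - (real (n - k * l) * p)"
      using kl by (simp add: of_nat_diff algebra_simps)
    finally show ?thesis using restp p0 by simp
  qed
  moreover have "\<bar>prob (avoid M T A (k * l)) - prob (avoid M T A n)\<bar> \<le> real k * real t * p"
    using prob_avoid_le_add[OF A kl] prob_avoid_mono[OF A kl] restp by (simp add: p_def)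
  ultimately show ?thesis
    unfolding p_def[symmetric] l_def[symmetric] S_def[symmetric] by linarith
qed

section \<open>Exceedances, escape sets and the conditions on the process\<close>

lemma X_eq_X0_funpow: "x \<in> space M \<Longrightarrow> X 0 ((T ^^ i) x) = X i x"
proof -
  \<comment> \<open>The index \<open>j\<close> must vary in the induction, since
    \<open>X_shift\<close> trades the outermost \<open>T\<close> for a larger index.\<close>
  have "x \<in> space M \<Longrightarrow> X j ((T ^^ i) x) = X (i + j) x" for j
    by (induction i arbitrary: j) (auto simp: X_shift funpow_in_space)
  then show "x \<in> space M \<Longrightarrow> X 0 ((T ^^ i) x) = X i x" by simp
qed

lemma sets_exceedance [measurable]: "exceedance M X v \<in> sets M"
  using X_measurable[of 0] unfolding exceedance_def by measurable

lemma exceedance_funpow_iff: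
  "x \<in> space M \<Longrightarrow> (T ^^ i) x \<in> exceedance M X v \<longleftrightarrow> X i x > v"
  by (simp add: exceedance_def funpow_in_space X_eq_X0_funpow)

lemma sets_escape_set [measurable]: "escape_set M T X q v \<in> sets M"
proof (cases "q = 0")
  case False
  then show ?thesis
    unfolding escape_set_def by (intro sets.Int sets.finite_INT) auto
qed (simp add: escape_set_def)

lemma escape_set_subset: "escape_set M T X q v \<subseteq> exceedance M X v"
  by (auto simp: escape_set_def)

lemma escape_set_funpow_iff:
  assumes "x \<in> space M"
  shows "(T ^^ i) x \<in> escape_set M T X q v \<longleftrightarrow> X i x > v \<and> (\<forall>j\<in>{1..q}. X (i + j) x \<le> v)"
  using assms by (auto simp: escape_set_def preimage_iter_iff exceedance_funpow_iff
      funpow_funpow_apply funpow_in_space not_less)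

text \<open>A visit now forbids exceedances at the next \<open>q\<close> times, whereas a visit at
  time \<open>j\<close> is itself an exceedance.\<close>

lemma escape_set_disjoint_preimage:
  assumes "1 \<le> j" "j \<le> q"
  shows "escape_set M T X q v \<inter> preimage_iter M T j (escape_set M T X q v) = {}"
proof -
  have False if "x \<in> escape_set M T X q v" "x \<in> preimage_iter M T j (escape_set M T X q v)" for x
  proof -
    have x: "x \<in> space M" using that(2) by (simp add: preimage_iter_iff)
    have "X j x \<le> v"
      using escape_set_funpow_iff[OF x, of 0 q v] that(1) assms by auto
    moreover have "X j x > v"
      using escape_set_funpow_iff[OF x, of j q v] that(2) by (auto simp: preimage_iter_iff)
    ultimately show False by simp
  qed
  then show ?thesis by auto
qed

text \<open>Bonferroni's inequality produces all lags from 1 on, while D'_q controls those from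
  \<open>q + 1\<close> on; the lags in between contribute zero.\<close>

lemma clustering_sum_from_one:
  "(\<Sum>j = 1..n div k - 1. prob (escape_set M T X q v \<inter> preimage_iter M T j (escape_set M T X q v)))
    = clustering_sum M T X q v n k"
  unfolding clustering_sum_def
  by (rule sum.mono_neutral_right) (auto simp: escape_set_disjoint_preimage not_le)

text \<open>For \<open>m = 0\<close> the two sides would differ in meaning: \<open>no_visit\<close>
  still inspects the single time \<open>j\<close>, but \<open>avoid\<close> inspects none.\<close>

lemma no_visit_eq_preimage_avoid:
  assumes "m \<ge> 1"
  shows "no_visit M T (real j) (real m) A = preimage_iter M T j (avoid M T A m)"
proof -
  have "nat (max (\<lfloor>real m\<rfloor> - 1) 0) = m - 1" by simp
  then have "no_visit M T (real j) (real m) A =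
      (\<Inter>i\<in>{j..j + (m - 1)}. preimage_iter M T i (space M - A))"
    by (simp add: no_visit_def)
  also have "\<dots> = {x \<in> space M. \<forall>i\<in>{j..j + (m - 1)}. (T ^^ i) x \<notin> A}"
  proof -
    \<comment> \<open>A nonempty index set keeps the intersection inside
      \<open>space M\<close>.\<close>
    have "j \<in> {j..j + (m - 1)}" by simp
    then show ?thesis
      by (auto simp only: preimage_iter_iff funpow_in_space INT_iff mem_Collect_eq Diff_iff)
  qed
  also have "\<dots> = {x \<in> space M. \<forall>i<m. (T ^^ (j + i)) x \<notin> A}"
  proof -
    have "(\<forall>i\<in>{j..j + (m - 1)}. P i) \<longleftrightarrow> (\<forall>i<m. P (j + i))" for P
    proof (intro iffI ballI allI impI)
      fix i assume "\<forall>i<m. P (j + i)" "i \<in> {j..j + (m - 1)}"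
      then show "P i"
        using assms by (auto dest: spec[of _ "i - j"])
    qed (use assms in auto)
    then show ?thesis by simp
  qed
  also have "\<dots> = preimage_iter M T j (avoid M T A m)"
    by (simp add: preimage_iter_avoid)
  finally show ?thesis .
qed

text \<open>Block estimates need one bound for all gaps \<open>j\<close> beyond \<open>t\<close>,
  because the distance from a visit to the next window depends on its position in the block.
  Antitonicity of \<gamma> in the gap provides it.\<close>

lemma cond_D_avoid:
  fixes u :: "nat \<Rightarrow> real" and q :: nat
  assumes D: "cond_D M T X u \<gamma>" and n: "n \<ge> 1" and t: "1 \<le> t" "t \<le> j"
  defines "A \<equiv> escape_set M T X q (u n)"
  shows "\<bar>prob (A \<inter> preimage_iter M T j (avoid M T A m)) - prob A * prob (avoid M T A m)\<bar>
    \<le> \<gamma> q n t"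
proof -
  have A: "A \<in> sets M" by (simp add: A_def)
  have D': "\<bar>prob (A \<inter> preimage_iter M T j (avoid M T A m')) - prob A * prob (avoid M T A m')\<bar>
      \<le> \<gamma> q n j" if "m' \<ge> 1" for m'
  proof -
    have "\<bar>prob (A \<inter> no_visit M T (real j) (real m') A)
        - prob A * prob (no_visit M T (real 0) (real m') A)\<bar> \<le> \<gamma> q n j"
      using D n t that unfolding cond_D_def A_def by simp
    then show ?thesis
      unfolding no_visit_eq_preimage_avoid[OF that] using A by (simp add: prob_preimage_iter)
  qed
  have "antimono_on {1..} (\<gamma> q n)"
    using D n by (simp add: cond_D_def)
  then have mono: "\<gamma> q n j \<le> \<gamma> q n t"
    using t by (auto simp: monotone_on_def)
  show ?thesis
  proof (cases "m = 0")
    \<comment> \<open>Condition D concerns lengths from 1 on. For the empty window the left side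
      vanishes, and the claim reduces to nonnegativity of \<gamma>.\<close>
    case True
    then have "avoid M T A m = space M" by (simp add: avoid_def)
    moreover have "preimage_iter M T j (space M) = space M"
      by (auto simp: preimage_iter_iff funpow_in_space)
    moreover have "0 \<le> \<gamma> q n j"
      using D'[of 1] by linarith
    ultimately show ?thesis using mono A by (simp add: prob_space)
  next
    case False
    then show ?thesis using D'[of m] mono by simp
  qed
qed

lemma partial_max_le_eq_avoid:
  assumes "n \<ge> 1"
  shows "{x \<in> space M. partial_max X n x \<le> v} = avoid M T (exceedance M X v) n"
proof -
  have "partial_max X n x \<le> v \<longleftrightarrow> (\<forall>i<n. X i x \<le> v)" for x
    unfolding partial_max_def using assms by (subst Max_le_iff) (auto simp: lessThan_empty_iff)
  then show ?thesis
    by (auto simp: avoid_def exceedance_funpow_iff not_less)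
qed

lemma prob_partial_max_diff_avoid_le:
  assumes "n \<ge> 1"
  shows "\<bar>prob {x \<in> space M. partial_max X n x \<le> v} - prob (avoid M T (escape_set M T X q v) n)\<bar>
    \<le> real q * prob (exceedance M X v - escape_set M T X q v)"
proof -
  define U where "U = exceedance M X v"
  define A where "A = escape_set M T X q v"
  have sets: "U \<in> sets M" "A \<in> sets M" "A \<subseteq> U"
    using escape_set_subset by (auto simp: U_def A_def)
  have "avoid M T A n \<subseteq> avoid M T U n \<union> (\<Union>i\<in>{n - q..<n}. preimage_iter M T i (U - A))"
  proof
    fix x assume "x \<in> avoid M T A n"
    then have x: "x \<in> space M" and nA: "\<And>i. i < n \<Longrightarrow> (T ^^ i) x \<notin> A"
      by (auto simp: avoid_def)
    show "x \<in> avoid M T U n \<union> (\<Union>i\<in>{n - q..<n}. preimage_iter M T i (U - A))"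
    proof (cases "\<exists>i<n. X i x > v")
      case False
      then show ?thesis
        using x by (simp add: avoid_def U_def exceedance_funpow_iff)
    next
      case True
      define I where "I = {i. i < n \<and> X i x > v}"
      have fin: "finite I" and "I \<noteq> {}"
        using True by (auto simp: I_def)
      define i where "i = Max I"
      have i: "i < n" "X i x > v"
        using Max_in[OF fin \<open>I \<noteq> {}\<close>] by (auto simp: i_def I_def)
      have later: "X j x \<le> v" if "i < j" "j < n" for j
      proof (rule ccontr)
        assume "\<not> X j x \<le> v"
        then have "j \<in> I" using that by (simp add: I_def)
        then have "j \<le> i" using fin by (simp add: i_def)
        then show False using that by simp
      qed
      \<comment> \<open>Otherwise the \<open>q\<close> times after the last exceedance
        \<open>i\<close> would all lie before \<open>n\<close> and be free of exceedances, making
        \<open>i\<close> a visit to \<open>A\<close>.\<close>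
      have "\<not> i + q < n"
      proof
        assume "i + q < n"
        then have "(T ^^ i) x \<in> A"
          unfolding A_def escape_set_funpow_iff[OF x] using i later by auto
        then show False using nA i by blast
      qed
      moreover have "x \<in> preimage_iter M T i (U - A)"
        using x i nA[of i] by (auto simp: preimage_iter_iff U_def exceedance_funpow_iff)
      ultimately show ?thesis using i by auto
    qed
  qed
  from prob_le_add_UN_preimage_iter[OF _ _ _ _ this] sets
  have "prob (avoid M T A n) \<le> prob (avoid M T U n) + real (card {n - q..<n}) * prob (U - A)"
    by simp
  \<comment> \<open>With truncated subtraction the window has \<open>min n q\<close> times, hence at
    most \<open>q\<close>.\<close>
  also have "\<dots> \<le> prob (avoid M T U n) + real q * prob (U - A)"
    by (intro add_left_mono mult_right_mono) auto
  finally have "prob (avoid M T A n) \<le> prob (avoid M T U n) + real q * prob (U - A)" .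
  moreover have "prob (avoid M T U n) \<le> prob (avoid M T A n)"
    using sets by (intro finite_measure_mono) (auto simp: avoid_def)
  ultimately show ?thesis
    unfolding partial_max_le_eq_avoid[OF assms] by (simp add: U_def A_def)
qed

lemma prob_escape_set_le: "prob (escape_set M T X q v) \<le> prob (exceedance M X v)"
  by (intro finite_measure_mono escape_set_subset) auto

lemma theta_nonneg: "theta M T X q v \<ge> 0"
  by (simp add: theta_def)

lemma theta_le_one: "theta M T X q v \<le> 1"
proof -
  have "theta M T X q v \<le> prob (exceedance M X v) / prob (exceedance M X v)"
    unfolding theta_def by (intro divide_right_mono prob_escape_set_le) simp
  also have "\<dots> \<le> 1" by simp
  finally show ?thesis .
qed

text \<open>This survives the convention for division by zero: a null exceedance set has a null
  escape set.\<close>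

lemma theta_mult_exceedance:
  "theta M T X q v * prob (exceedance M X v) = prob (escape_set M T X q v)"
  using measure_nonneg[of M "escape_set M T X q v"] prob_escape_set_le[of q v]
  by (cases "prob (exceedance M X v) = 0") (auto simp: theta_def intro: antisym)

section \<open>The estimate at a fixed time, and its asymptotic form\<close>

lemma partial_max_bound:
  fixes u :: "nat \<Rightarrow> real" and \<tau> :: real
  assumes D: "cond_D M T X u \<gamma>" and pos: "n \<ge> 1" "t \<ge> 1" "k \<ge> 1"
    and level: "real n * prob (exceedance M X (u n)) \<le> 2 * \<tau>" and \<tau>: "2 * \<tau> \<le> real k"
  shows "\<bar>prob {x \<in> space M. partial_max X n x \<le> u n} - exp (- (theta M T X q (u n) * \<tau>))\<bar>
    \<le> 8 * (real k * real t * (\<tau> / real n)) + real n * \<gamma> q n t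
      + real n * clustering_sum M T X q (u n) n k
      + (\<bar>\<tau> - real n * prob (exceedance M X (u n))\<bar> + 4 * (\<tau>\<^sup>2 / real k))
      + real q * prob (exceedance M X (u n) - escape_set M T X q (u n))"
proof -
  define A where "A = escape_set M T X q (u n)"
  define pU where "pU = prob (exceedance M X (u n))"
  define p where "p = prob A"
  define \<theta> where "\<theta> = theta M T X q (u n)"
  define l where "l = n div k"
  have A: "A \<in> sets M" by (simp add: A_def)
  have \<theta>: "0 \<le> \<theta>" "\<theta> \<le> 1" "p = \<theta> * pU"
    by (auto simp: \<theta>_def p_def pU_def A_def theta_nonneg theta_le_one theta_mult_exceedance)
  have p: "0 \<le> p" "p \<le> pU"
    using \<theta> by (auto simp: p_def pU_def mult_left_le_one_le)
  have \<tau>0: "0 \<le> \<tau>"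
    using level by (smt (verit) mult_nonneg_nonneg of_nat_0_le_iff measure_nonneg)
  have "real n * p \<le> 2 * \<tau>"
    using p level by (smt (verit) mult_left_mono of_nat_0_le_iff pU_def)
  \<comment> \<open>Together with the bound on \<open>n * p\<close> this gives \<open>l * p\<close>
    at most \<open>2 * \<tau> / k\<close>, hence at most 1 by the assumption on \<open>k\<close>.
    Its square is the source of the factor 4 in front of \<open>\<tau>\<^sup>2 / k\<close>.\<close>
  moreover have "real k * real l \<le> real n"
    unfolding l_def by (metis of_nat_mult of_nat_le_iff mult.commute div_times_less_eq_dividend)
  then have "real k * real l * p \<le> real n * p"
    using p by (intro mult_right_mono)
  ultimately have klp: "real k * (real l * p) \<le> 2 * \<tau>"
    by simp
  then have lp: "real l * p \<le> 2 * \<tau> / real k"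
    using pos by (simp add: field_simps)
  also have "\<dots> \<le> 1"
    using \<tau> pos by simp
  finally have small: "real l * p \<le> 1" .
  have mix: "\<bar>prob (A \<inter> preimage_iter M T j (avoid M T A m)) - prob A * prob (avoid M T A m)\<bar>
      \<le> \<gamma> q n t" if "t \<le> j" for m j
    unfolding A_def using D pos that by (intro cond_D_avoid) auto
  have blocks: "\<bar>prob (avoid M T A n) - exp (- (real n * p))\<bar>
      \<le> 4 * (real k * real t * p) + real n * clustering_sum M T X q (u n) n k
        + real n * \<gamma> q n t + real k * (real l * p)\<^sup>2"
    using avoid_blocks_bound[OF A mix pos(3,2), of n] small
    unfolding A_def clustering_sum_from_one by (simp add: p_def l_def A_def)
  have "real k * (real l * p)\<^sup>2 \<le> real k * (2 * \<tau> / real k)\<^sup>2"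
    using lp p by (intro mult_left_mono power_mono) auto
  also have "\<dots> = 4 * (\<tau>\<^sup>2 / real k)"
    using pos by (simp add: power2_eq_square)
  finally have square: "real k * (real l * p)\<^sup>2 \<le> 4 * (\<tau>\<^sup>2 / real k)" .
  have "p \<le> 2 * (\<tau> / real n)"
    using \<open>real n * p \<le> 2 * \<tau>\<close> pos by (simp add: field_simps)
  then have "real k * real t * p \<le> real k * real t * (2 * (\<tau> / real n))"
    by (intro mult_left_mono) auto
  then have gaps: "4 * (real k * real t * p) \<le> 8 * (real k * real t * (\<tau> / real n))"
    by simp
  \<comment> \<open>As \<open>p\<close> is \<theta> times \<open>pU\<close>, the exponents differ by
    \<theta> times the deviation of \<open>n * pU\<close> from \<tau>.\<close>
  have "\<bar>exp (- (real n * p)) - exp (- (\<theta> * \<tau>))\<bar> \<le> \<bar>real n * p - \<theta> * \<tau>\<bar>"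
    using p \<theta> \<tau>0 by (intro abs_exp_minus_diff_le) auto
  also have "real n * p - \<theta> * \<tau> = - (\<theta> * (\<tau> - real n * pU))"
    by (simp add: \<theta>(3) algebra_simps)
  also have "\<bar>\<dots>\<bar> \<le> \<bar>\<tau> - real n * pU\<bar>"
    using \<theta> by (simp add: abs_mult mult_left_le_one_le)
  finally have "\<bar>exp (- (real n * p)) - exp (- (\<theta> * \<tau>))\<bar> \<le> \<bar>\<tau> - real n * pU\<bar>" .
  then show ?thesis
    using blocks square gaps prob_partial_max_diff_avoid_le[OF pos(1), of "u n" q]
    unfolding \<theta>_def[symmetric] pU_def[symmetric] A_def[symmetric] by linarith
qed

end

theorem theorem2p3:
  fixes M :: "'a measure" and T :: "'a \<Rightarrow> 'a" and X :: "nat \<Rightarrow> 'a \<Rightarrow> real"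
    and u :: "nat \<Rightarrow> real" and \<tau> :: real and q :: nat
    and \<gamma> :: "nat \<Rightarrow> nat \<Rightarrow> nat \<Rightarrow> real" and t k :: "nat \<Rightarrow> nat"
  assumes "stationary_process M T X"
    and "\<tau> > 0"
    and "(\<lambda>n. real n * measure M {x \<in> space M. X 0 x > u n}) \<longlonglongrightarrow> \<tau>"
    and "cond_D M T X u \<gamma>"
    and "gap_sequence \<gamma> q t"
    and "cond_D' M T X u q t k"
  shows "\<exists>C>0. \<forall>\<^sub>F n in sequentially.
    \<bar>measure M {x \<in> space M. partial_max X n x \<le> u n} - exp (- (theta M T X q (u n) * \<tau>))\<bar>
    \<le> C * (real (k n) * real (t n) * (\<tau> / real n)
           + real n * \<gamma> q n (t n)
           + real n * clustering_sum M T X q (u n) n (k n)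
           + exp (- (theta M T X q (u n) * \<tau>))
             * (\<bar>\<tau> - real n * measure M (exceedance M X (u n))\<bar> + \<tau>\<^sup>2 / real (k n))
           + real q * measure M (exceedance M X (u n) - escape_set M T X q (u n)))"
proof -
  interpret stationary_process M T X by fact
  have exceed: "(\<lambda>n. real n * prob (exceedance M X (u n))) \<longlonglongrightarrow> \<tau>"
    using assms(3) by (simp add: exceedance_def)
  have k: "filterlim k at_top sequentially" "\<And>n. n \<ge> 1 \<Longrightarrow> k n \<ge> 1"
    using assms(6) by (auto simp: cond_D'_def)
  have t: "\<And>n. n \<ge> 1 \<Longrightarrow> t n \<ge> 1"
    using assms(5) by (auto simp: gap_sequence_def)
  have "eventually (\<lambda>n. real n * prob (exceedance M X (u n)) < 2 * \<tau>) sequentially"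
    using order_tendstoD(2)[OF exceed] \<open>\<tau> > 0\<close> by simp
  moreover have "eventually (\<lambda>n. 2 * \<tau> \<le> real (k n)) sequentially"
    using filterlim_compose[OF filterlim_real_sequentially k(1)] by (simp add: filterlim_at_top)
  moreover have "eventually (\<lambda>n. n \<ge> (1::nat)) sequentially"
    by (rule eventually_ge_at_top)
  \<comment> \<open>In \<open>C = 8 * exp \<tau>\<close>, the 8 is the largest constant of
    \<open>partial_max_bound\<close>, and \<open>exp \<tau>\<close> compensates for the factor
    \<open>exp (- (\<theta> * \<tau>))\<close> that the stated bound puts on one of its
    terms.\<close>
  ultimately have "\<forall>\<^sub>F n in sequentially.
    \<bar>measure M {x \<in> space M. partial_max X n x \<le> u n} - exp (- (theta M T X q (u n) * \<tau>))\<bar>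
    \<le> 8 * exp \<tau> * (real (k n) * real (t n) * (\<tau> / real n)
           + real n * \<gamma> q n (t n)
           + real n * clustering_sum M T X q (u n) n (k n)
           + exp (- (theta M T X q (u n) * \<tau>))
             * (\<bar>\<tau> - real n * measure M (exceedance M X (u n))\<bar> + \<tau>\<^sup>2 / real (k n))
           + real q * measure M (exceedance M X (u n) - escape_set M T X q (u n)))"
  proof eventually_elim
    case (elim n)
    define a b c d e where
      "a = real (k n) * real (t n) * (\<tau> / real n)" and
      "b = real n * \<gamma> q n (t n)" and
      "c = real n * clustering_sum M T X q (u n) n (k n)" and
      "d = \<bar>\<tau> - real n * measure M (exceedance M X (u n))\<bar> + \<tau>\<^sup>2 / real (k n)" and
      "e = real q * measure M (exceedance M X (u n) - escape_set M T X q (u n))"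
    define h where "h = exp (- (theta M T X q (u n) * \<tau>))"
    \<comment> \<open>Enlarging all constants to a common one requires every term to be nonnegative;
      for \<gamma> this holds because it bounds an absolute value.\<close>
    have "0 \<le> \<gamma> q n (t n)"
      using cond_D_avoid[OF assms(4) elim(3) t[OF elim(3)] order.refl, of q 0] by linarith
    then have nonneg: "0 \<le> a" "0 \<le> b" "0 \<le> c" "0 \<le> d" "0 \<le> e"
      using \<open>\<tau> > 0\<close> by (auto simp: a_def b_def c_def d_def e_def clustering_sum_def
          intro!: mult_nonneg_nonneg sum_nonneg)
    have "theta M T X q (u n) * \<tau> \<le> \<tau>"
      using theta_le_one theta_nonneg \<open>\<tau> > 0\<close> by (simp add: mult_left_le_one_le)
    then have h: "1 \<le> exp \<tau> * h"
      by (simp add: h_def flip: exp_add)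
    have "\<bar>measure M {x \<in> space M. partial_max X n x \<le> u n} - h\<bar> \<le> 8 * (a + b + c + d + e)"
    proof -
      have "0 \<le> \<tau>\<^sup>2 / real (k n)" by simp
      then show ?thesis
        using partial_max_bound[OF assms(4) elim(3) t[OF elim(3)] k(2)[OF elim(3)], of \<tau> q]
          elim(1,2) nonneg
        unfolding a_def[symmetric] b_def[symmetric] c_def[symmetric] e_def[symmetric]
          h_def[symmetric] d_def by argo
    qed
    also have "a + b + c + d + e \<le> exp \<tau> * (a + b + c + h * d + e)"
    proof -
      have "1 \<le> exp \<tau>" using \<open>\<tau> > 0\<close> by simp
      then have "1 * (a + b + c + e) \<le> exp \<tau> * (a + b + c + e)"
        using nonneg by (intro mult_right_mono) auto
      moreover have "1 * d \<le> exp \<tau> * h * d"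
        using h nonneg by (intro mult_right_mono) auto
      ultimately show ?thesis by (simp add: algebra_simps)
    qed
    finally show ?case
      by (simp add: a_def b_def c_def d_def e_def h_def mult.assoc)
  qed
  then show ?thesis
    by (intro exI[of _ "8 * exp \<tau>"]) simp
qed

end
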